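(* Let $f=\frac1n\sum_{i=1}^nf_i$ be $\mu$-strongly convex ($\mu>0$) with minimizer $x^*$, where each $f_i:\mathbb{R}^d\to\mathbb{R}$ is convex and smooth with smoothness constant $L_i$; let $\varepsilon>0$, and let $\mathcal C_1,\dots,\mathcal C_K$ be a partition of $\{1,\dots,n\}$ with probabilities $q_{\mathcal C_j}>0$, $\sum_jq_{\mathcal C_j}=1$. Call optimal batch size a minimizer over $\tau$ of $$\Phi(\tau)=\max\left\{\tau\mathcal L(\tau),\ \frac{2}{\varepsilon\mu}\,\tau\sigma(x^*,\tau)\right\},$$ where $\tau\mathcal L(\tau)$ and $\tau\sigma(x^*,\tau)$ are the piecewise linear, respectively linear, functions of the real variable $\tau$ given in the context for each of the two samplings. (a) $\tau$-partition nice sampling (with $n_{\mathcal C_j}\ge2$ for all $j$). If $\sum_{\mathcal C_j}\frac{n_{\mathcal C_j}^2}{e_{\mathcal C_j}}\left(h_{\mathcal C_j}^*n_{\mathcal C_j}-\overline h_{\mathcal C_j}^*\right)\le0$, then the optimal batch size, i.e. a minimizer of $\Phi$ over $\tau\in\mathbb{R}$, is $\tau(x^* )$, where $$\tau(x)=\min_{\mathcal C_r}\frac{\frac{n\,n_{\mathcal C_r}^2}{e_{\mathcal C_r}}\left(L_{\mathcal C_r}-L_{\max}^{\mathcal C_r}\right)+\frac{2}{\varepsilon\mu}\sum_{\mathcal C_j}\frac{n_{\mathcal C_j}^3}{e_{\mathcal C_j}}\left(\overline h_{\mathcal C_j}(x)-h_{\mathcal C_j}(x)\right)}{\frac{n\,n_{\mathcal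 C_r}}{e_{\mathcal C_r}}\left(n_{\mathcal C_r}L_{\mathcal C_r}-L_{\max}^{\mathcal C_r}\right)+\frac{2}{\varepsilon\mu}\sum_{\mathcal C_j}\frac{n_{\mathcal C_j}^2}{e_{\mathcal C_j}}\left(\overline h_{\mathcal C_j}(x)-n_{\mathcal C_j}h_{\mathcal C_j}(x)\right)}.$$ Otherwise the optimal batch size is $\tau(x^* )=1$, i.e. $\tau=1$ minimizes $\Phi$ over real $\tau\ge1$. (b) $\tau$-partition independent sampling with $p_i=\frac{\tau}{n_{\mathcal C_j}}$ for $i\in\mathcal C_j$. If $\sum_{\mathcal C_j}\frac{n_{\mathcal C_j}}{q_{\mathcal C_j}}\left(n_{\mathcal C_j}h_{\mathcal C_j}^*-\overline h_{\mathcal C_j}^*\right)\le0$, then the optimal batch size, i.e. a minimizer of $\Phi$ over $\tau\in\mathbb{R}$, is $\tau(x^* )$, where $$\tau(x)=\min_{\mathcal C_r}\frac{\frac{2}{\varepsilon\mu}\sum_{\mathcal C_j}\frac{n_{\mathcal C_j}^2}{q_{\mathcal C_j}}\overline h_{\mathcal C_j}(x)-\frac{n\,n_{\mathcal C_r}}{q_{\mathcal C_r}}L_{\max}^{\mathcal C_r}}{\frac{2}{\varepsilon\mu}\sum_{\mathcal C_j}\frac{n_{\mathcal C_j}}{q_{\mathcal C_j}}\left(\overline h_{\mathcal C_j}(x)-n_{\mathcal C_j}h_{\mathcal C_j}(x)\right)+\frac{n}{q_{\mathcal C_r}}\left(n_{\mathcal C_r}L_{\mathcal C_r}-L_{\max}^{\mathcal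 C_r}\right)}.$$ Otherwise the optimal batch size is $\tau(x^* )=1$, i.e. $\tau=1$ minimizes $\Phi$ over real $\tau\ge1$. (In both cases the denominators at $x=x^*$ are assumed nonzero, so that the formulas make sense.)
   Context: Notation: $n_{\mathcal C_j}=|\mathcal C_j|$; $f_{\mathcal C_j}=\frac1{n_{\mathcal C_j}}\sum_{i\in\mathcal C_j}f_i$; $L_i$ and $L_{\mathcal C_j}$ are the smoothness constants (smallest Lipschitz constants of the gradient) of $f_i$ and $f_{\mathcal C_j}$; $L_{\max}^{\mathcal C_r}=\max_{i\in\mathcal C_r}L_i$; $e_{\mathcal C_j}=q_{\mathcal C_j}(n_{\mathcal C_j}-1)$; $h_i(x)=\|\nabla f_i(x)\|^2$; $h_{\mathcal C_j}(x)=\|\nabla f_{\mathcal C_j}(x)\|^2$; $\overline h_{\mathcal C_j}(x)=\frac1{n_{\mathcal C_j}}\sum_{i\in\mathcal C_j}h_i(x)$; a superscript $*$ means evaluation at $x^*$ (e.g. $h_{\mathcal C_j}^*=h_{\mathcal C_j}(x^* )$). In $\tau$-partition nice sampling one picks $\mathcal C_j$ with probability $q_{\mathcal C_j}$ and then a uniformly random subset of $\mathcal C_j$ of size $\tau$; in $\tau$-partition independent sampling one picks $\mathcal C_j$ with probability $q_{\mathcal C_j}$ and then includes each $i\in\mathcal C_j$ independently with probability $p_i$. The quantities $\mathcal L(\tau)$ (bound on the expected smoothness constant) and $\sigma(x^*,\tau)$ (gradient noise) of these samplings give the following functions, considered for real $\tau$. For $\tau$-partition nice sampling: $$\tau\mathcal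 L(\tau)=\frac1n\max_{\mathcal C_j}\frac{n_{\mathcal C_j}}{e_{\mathcal C_j}}\Big[(\tau-1)L_{\mathcal C_j}n_{\mathcal C_j}+(n_{\mathcal C_j}-\tau)L_{\max}^{\mathcal C_j}\Big],$$ $$\tau\sigma(x^*,\tau)=\frac1{n^2}\sum_{\mathcal C_j}\frac{n_{\mathcal C_j}^2}{e_{\mathcal C_j}}\Big[(\tau-1)h_{\mathcal C_j}^*n_{\mathcal C_j}+(n_{\mathcal C_j}-\tau)\overline h_{\mathcal C_j}^*\Big].$$ For $\tau$-partition independent sampling with $p_i=\tau/n_{\mathcal C_j}$ for $i\in\mathcal C_j$: $$\tau\mathcal L(\tau)=\frac1n\max_{\mathcal C_j}\frac{1}{q_{\mathcal C_j}}\Big[\tau n_{\mathcal C_j}L_{\mathcal C_j}+(n_{\mathcal C_j}-\tau)L_{\max}^{\mathcal C_j}\Big],$$ $$\tau\sigma(x^*,\tau)=\frac1{n^2}\sum_{\mathcal C_j}\frac{1}{q_{\mathcal C_j}}\Big[\tau n_{\mathcal C_j}^2h_{\mathcal C_j}^*+(n_{\mathcal C_j}-\tau)n_{\mathcal C_j}\overline h_{\mathcal C_j}^*\Big].$$ *)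

theory Defs
  imports "HOL-Analysis.Analysis"
begin

definition gradient :: "('a::real_inner \<Rightarrow> real) \<Rightarrow> 'a \<Rightarrow> 'a" where
  "gradient g x = (THE D. GDERIV g x :> D)"

lemma gradient_eq:
  assumes "GDERIV g x :> D"
  shows "gradient g x = D"
  unfolding gradient_def
proof (rule the_equality)
  show "GDERIV g x :> D" by (fact assms)
  fix E assume "GDERIV g x :> E"
  then have "(\<lambda>h. inner h E) = (\<lambda>h. inner h D)"
    using assms unfolding gderiv_def by (rule has_derivative_unique)
  then show "E = D"
    by (metis inner_commute vector_eq_rdot)
qed

definition L_smooth :: "real \<Rightarrow> ('a::real_inner \<Rightarrow> real) \<Rightarrow> bool" where
  "L_smooth L g \<longleftrightarrow> (\<forall>x. g differentiable (at x)) \<and> L-lipschitz_on UNIV (gradient g)"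

definition smoothness_const :: "('a::real_inner \<Rightarrow> real) \<Rightarrow> real" where
  "smoothness_const g = Inf {L. L_smooth L g}"

(* The infimum is attained, so smoothness_const g is the smallest Lipschitz constant. *)
lemma L_smooth_smoothness_const:
  assumes "L_smooth L g"
  shows "L_smooth (smoothness_const g) g"
proof -
  let ?S = "{L. L_smooth L g}"
  have ne: "?S \<noteq> {}" using assms by blast
  have nonneg: "0 \<le> Inf ?S"
    using ne by (rule cInf_greatest) (auto simp: L_smooth_def lipschitz_on_def)
  have "dist (gradient g x) (gradient g y) \<le> Inf ?S * dist x y" for x y
  proof (cases "x = y")
    case False
    then have pos: "dist x y > 0" by simp
    have "dist (gradient g x) (gradient g y) / dist x y \<le> Inf ?S"
      using ne
    proof (rule cInf_greatest)
      fix M assume "M \<in> ?S"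
      then show "dist (gradient g x) (gradient g y) / dist x y \<le> M"
        using pos by (auto simp: L_smooth_def lipschitz_on_def pos_divide_le_eq)
    qed
    then show ?thesis using pos by (simp add: pos_divide_le_eq)
  qed simp
  then show ?thesis
    using assms nonneg by (auto simp: L_smooth_def lipschitz_on_def smoothness_const_def)
qed

definition strongly_convex :: "real \<Rightarrow> ('a::real_inner \<Rightarrow> real) \<Rightarrow> bool" where
  "strongly_convex \<mu> g \<longleftrightarrow>
     (\<forall>x y t. 0 \<le> t \<and> t \<le> 1 \<longrightarrow>
        g ((1 - t) *\<^sub>R x + t *\<^sub>R y)
          \<le> (1 - t) * g x + t * g y - \<mu> / 2 * t * (1 - t) * (norm (x - y))\<^sup>2)"

definition avg_on :: "(nat \<Rightarrow> 'a \<Rightarrow> real) \<Rightarrow> nat set \<Rightarrow> 'a \<Rightarrow> real" where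
  "avg_on f C x = 1 / real (card C) * (\<Sum>i\<in>C. f i x)"

definition L_block :: "(nat \<Rightarrow> 'a::real_inner \<Rightarrow> real) \<Rightarrow> nat set \<Rightarrow> real" where
  "L_block f C = smoothness_const (avg_on f C)"

definition L_max :: "(nat \<Rightarrow> 'a::real_inner \<Rightarrow> real) \<Rightarrow> nat set \<Rightarrow> real" where
  "L_max f C = (MAX i\<in>C. smoothness_const (f i))"

definition h_block :: "(nat \<Rightarrow> 'a::real_inner \<Rightarrow> real) \<Rightarrow> nat set \<Rightarrow> 'a \<Rightarrow> real" where
  "h_block f C x = (norm (gradient (avg_on f C) x))\<^sup>2"

definition h_bar :: "(nat \<Rightarrow> 'a::real_inner \<Rightarrow> real) \<Rightarrow> nat set \<Rightarrow> 'a \<Rightarrow> real" where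
  "h_bar f C x = avg_on (\<lambda>i y. (norm (gradient (f i) y))\<^sup>2) C x"

definition e_block :: "(nat set \<Rightarrow> real) \<Rightarrow> nat set \<Rightarrow> real" where
  "e_block q C = q C * (real (card C) - 1)"

(* A partition is a set P of blocks, and q C is the probability of picking the block C.
   The products \<tau> * L(\<tau>) and \<tau> * sigma(x, \<tau>) are single functions of a real \<tau>,
   hence also defined where dividing by \<tau> would not make sense. *)

definition nice_tau_L ::
  "nat \<Rightarrow> nat set set \<Rightarrow> (nat set \<Rightarrow> real) \<Rightarrow> (nat \<Rightarrow> 'a::real_inner \<Rightarrow> real) \<Rightarrow> real \<Rightarrow> real" where
  "nice_tau_L n P q f \<tau> =
     1 / real n * (MAX C\<in>P. real (card C) / e_block q C *
       ((\<tau> - 1) * L_block f C * real (card C) + (real (card C) - \<tau>) * L_max f C))"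

definition nice_tau_sigma ::
  "nat \<Rightarrow> nat set set \<Rightarrow> (nat set \<Rightarrow> real) \<Rightarrow> (nat \<Rightarrow> 'a::real_inner \<Rightarrow> real) \<Rightarrow> 'a \<Rightarrow> real \<Rightarrow> real" where
  "nice_tau_sigma n P q f x \<tau> =
     1 / (real n)\<^sup>2 * (\<Sum>C\<in>P. (real (card C))\<^sup>2 / e_block q C *
       ((\<tau> - 1) * h_block f C x * real (card C) + (real (card C) - \<tau>) * h_bar f C x))"

definition indep_tau_L ::
  "nat \<Rightarrow> nat set set \<Rightarrow> (nat set \<Rightarrow> real) \<Rightarrow> (nat \<Rightarrow> 'a::real_inner \<Rightarrow> real) \<Rightarrow> real \<Rightarrow> real" where
  "indep_tau_L n P q f \<tau> =
     1 / real n * (MAX C\<in>P. 1 / q C *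
       (\<tau> * real (card C) * L_block f C + (real (card C) - \<tau>) * L_max f C))"

definition indep_tau_sigma ::
  "nat \<Rightarrow> nat set set \<Rightarrow> (nat set \<Rightarrow> real) \<Rightarrow> (nat \<Rightarrow> 'a::real_inner \<Rightarrow> real) \<Rightarrow> 'a \<Rightarrow> real \<Rightarrow> real" where
  "indep_tau_sigma n P q f x \<tau> =
     1 / (real n)\<^sup>2 * (\<Sum>C\<in>P. 1 / q C *
       (\<tau> * (real (card C))\<^sup>2 * h_block f C x
         + (real (card C) - \<tau>) * real (card C) * h_bar f C x))"

definition complexity :: "real \<Rightarrow> real \<Rightarrow> (real \<Rightarrow> real) \<Rightarrow> (real \<Rightarrow> real) \<Rightarrow> real \<Rightarrow> real" where
  "complexity \<epsilon> \<mu> tau_L tau_sigma \<tau> = max (tau_L \<tau>) (2 / (\<epsilon> * \<mu>) * tau_sigma \<tau>)"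

definition nice_num ::
  "nat \<Rightarrow> nat set set \<Rightarrow> (nat set \<Rightarrow> real) \<Rightarrow> (nat \<Rightarrow> 'a::real_inner \<Rightarrow> real) \<Rightarrow> real \<Rightarrow> real \<Rightarrow> 'a
    \<Rightarrow> nat set \<Rightarrow> real" where
  "nice_num n P q f \<epsilon> \<mu> x R =
     real n * (real (card R))\<^sup>2 / e_block q R * (L_block f R - L_max f R)
     + 2 / (\<epsilon> * \<mu>) * (\<Sum>C\<in>P. (real (card C))^3 / e_block q C * (h_bar f C x - h_block f C x))"

definition nice_den ::
  "nat \<Rightarrow> nat set set \<Rightarrow> (nat set \<Rightarrow> real) \<Rightarrow> (nat \<Rightarrow> 'a::real_inner \<Rightarrow> real) \<Rightarrow> real \<Rightarrow> real \<Rightarrow> 'a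
    \<Rightarrow> nat set \<Rightarrow> real" where
  "nice_den n P q f \<epsilon> \<mu> x R =
     real n * real (card R) / e_block q R * (real (card R) * L_block f R - L_max f R)
     + 2 / (\<epsilon> * \<mu>) * (\<Sum>C\<in>P. (real (card C))\<^sup>2 / e_block q C *
         (h_bar f C x - real (card C) * h_block f C x))"

definition nice_tau ::
  "nat \<Rightarrow> nat set set \<Rightarrow> (nat set \<Rightarrow> real) \<Rightarrow> (nat \<Rightarrow> 'a::real_inner \<Rightarrow> real) \<Rightarrow> real \<Rightarrow> real \<Rightarrow> 'a
    \<Rightarrow> real" where
  "nice_tau n P q f \<epsilon> \<mu> x = (MIN R\<in>P. nice_num n P q f \<epsilon> \<mu> x R / nice_den n P q f \<epsilon> \<mu> x R)"

definition indep_num ::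
  "nat \<Rightarrow> nat set set \<Rightarrow> (nat set \<Rightarrow> real) \<Rightarrow> (nat \<Rightarrow> 'a::real_inner \<Rightarrow> real) \<Rightarrow> real \<Rightarrow> real \<Rightarrow> 'a
    \<Rightarrow> nat set \<Rightarrow> real" where
  "indep_num n P q f \<epsilon> \<mu> x R =
     2 / (\<epsilon> * \<mu>) * (\<Sum>C\<in>P. (real (card C))\<^sup>2 / q C * h_bar f C x)
     - real n * real (card R) / q R * L_max f R"

definition indep_den ::
  "nat \<Rightarrow> nat set set \<Rightarrow> (nat set \<Rightarrow> real) \<Rightarrow> (nat \<Rightarrow> 'a::real_inner \<Rightarrow> real) \<Rightarrow> real \<Rightarrow> real \<Rightarrow> 'a
    \<Rightarrow> nat set \<Rightarrow> real" where
  "indep_den n P q f \<epsilon> \<mu> x R =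
     2 / (\<epsilon> * \<mu>) * (\<Sum>C\<in>P. real (card C) / q C * (h_bar f C x - real (card C) * h_block f C x))
     + real n / q R * (real (card R) * L_block f R - L_max f R)"

definition indep_tau ::
  "nat \<Rightarrow> nat set set \<Rightarrow> (nat set \<Rightarrow> real) \<Rightarrow> (nat \<Rightarrow> 'a::real_inner \<Rightarrow> real) \<Rightarrow> real \<Rightarrow> real \<Rightarrow> 'a
    \<Rightarrow> real" where
  "indep_tau n P q f \<epsilon> \<mu> x = (MIN R\<in>P. indep_num n P q f \<epsilon> \<mu> x R / indep_den n P q f \<epsilon> \<mu> x R)"

end

theory Submission
  imports Defs
begin

text \<open>
  In \<open>\<tau>\<close>, the function \<open>\<Phi>\<close> is the maximum of finitely many lines coming from \<open>\<tau> L(\<tau>)\<close> and of one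
  line coming from \<open>\<tau> \<sigma>(\<tau>)\<close>. The former have nonnegative slopes, because a convex summand of an
  \<open>M\<close>-smooth function is itself \<open>M\<close>-smooth, so that the maximal smoothness constant in a block is at
  most the block size times the smoothness constant of the block average. If the line of \<open>\<sigma>\<close> is
  nonincreasing, \<open>\<Phi>\<close> is minimal where it first meets one of the other lines; otherwise \<open>\<Phi>\<close> is
  nondecreasing.
\<close>

section \<open>Smoothness of convex summands\<close>

text \<open>The derivative is a linear functional, and in a Euclidean space its values on
  \<open>Basis\<close> are the coordinates of a vector representing it. So the vector described by
  \<open>THE\<close> in \<open>gradient\<close> exists.\<close>

lemma GDERIV_gradient:
  fixes g :: "'a::euclidean_space \<Rightarrow> real"
  assumes "g differentiable (at x)"
  shows "GDERIV g x :> gradient g x"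
proof -
  obtain g' where g': "(g has_derivative g') (at x)"
    using assms by (auto simp: differentiable_def)
  interpret g': bounded_linear g' using g' by (rule has_derivative_bounded_linear)
  have "g' h = inner h (\<Sum>b\<in>Basis. g' b *\<^sub>R b)" for h
  proof -
    have "g' h = g' (\<Sum>b\<in>Basis. inner h b *\<^sub>R b)" by (simp add: euclidean_representation)
    also have "\<dots> = (\<Sum>b\<in>Basis. inner h b * g' b)" by (simp add: g'.sum g'.scaleR)
    also have "\<dots> = inner h (\<Sum>b\<in>Basis. g' b *\<^sub>R b)"
      by (simp add: inner_sum_right mult.commute)
    finally show ?thesis .
  qed
  then have "g' = (\<lambda>h. inner h (\<Sum>b\<in>Basis. g' b *\<^sub>R b))" by blast
  then have "GDERIV g x :> (\<Sum>b\<in>Basis. g' b *\<^sub>R b)"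
    unfolding gderiv_def using g' by simp
  then show ?thesis by (simp add: gradient_eq)
qed

lemma GDERIV_sum:
  assumes "\<And>i. i \<in> C \<Longrightarrow> GDERIV (f i) x :> D i"
  shows "GDERIV (\<lambda>x. \<Sum>i\<in>C. f i x) x :> (\<Sum>i\<in>C. D i)"
  unfolding gderiv_def inner_sum_right
  by (rule has_derivative_sum) (use assms in \<open>simp add: gderiv_def\<close>)

lemma GDERIV_cmult:
  assumes "GDERIV g x :> D"
  shows "GDERIV (\<lambda>x. c * g x) x :> c *\<^sub>R D"
  using has_derivative_mult_right[of g "\<lambda>h. inner h D" "at x" c] assms
  by (simp add: gderiv_def)

lemma DERIV_along_line:
  assumes "GDERIV g (x + t *\<^sub>R d) :> D"
  shows "((\<lambda>t. g (x + t *\<^sub>R d)) has_field_derivative inner D d) (at t)"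
proof -
  have line: "((\<lambda>t. x + t *\<^sub>R d) has_derivative (\<lambda>h. h *\<^sub>R d)) (at t)"
    by (auto intro!: derivative_eq_intros)
  have "((\<lambda>t. g (x + t *\<^sub>R d)) has_derivative (\<lambda>h. inner (h *\<^sub>R d) D)) (at t)"
    using has_derivative_compose[OF line] assms unfolding gderiv_def by blast
  then show ?thesis
    by (simp add: has_field_derivative_def inner_commute mult.commute[of _ "inner _ _"]
        mult_commute_abs)
qed

text \<open>Restriction to the line through \<open>x\<close> and \<open>y\<close> reduces this to
  one real variable: the tangent at parameter 0 is compared with the function at parameter
  1.\<close>

lemma convex_above_tangent:
  assumes "convex_on UNIV g" and "GDERIV g x :> D"
  shows "g x + inner D (y - x) \<le> g y"
proof -
  let ?l = "\<lambda>t::real. g (x + t *\<^sub>R (y - x))"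
  have "convex_on UNIV ?l"
  proof (rule convex_onI)
    fix t u v :: real assume t: "0 < t" "t < 1"
    have "x + ((1 - t) *\<^sub>R u + t *\<^sub>R v) *\<^sub>R (y - x)
      = (1 - t) *\<^sub>R (x + u *\<^sub>R (y - x)) + t *\<^sub>R (x + v *\<^sub>R (y - x))"
      by (simp add: algebra_simps)
    then show "?l ((1 - t) *\<^sub>R u + t *\<^sub>R v) \<le> (1 - t) * ?l u + t * ?l v"
      using convex_onD[OF assms(1), of t] t by simp
  qed simp
  moreover have "(?l has_field_derivative inner D (y - x)) (at 0 within UNIV)"
    using DERIV_along_line[of g x 0 "y - x" D] assms(2) by simp
  ultimately have "?l 1 - ?l 0 \<ge> inner D (y - x) * (1 - 0)"
    by (intro convex_on_imp_above_tangent[of UNIV]) auto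
  then show ?thesis by simp
qed

text \<open>The descent lemma. Along the segment from \<open>x\<close> to \<open>y\<close> the
  directional derivative grows at most linearly, by Cauchy-Schwarz and the Lipschitz bound;
  monotonicity then replaces integration.\<close>

lemma lipschitz_gradient_quadratic_upper_bound:
  assumes deriv: "\<And>x. GDERIV F x :> G x" and lip: "M-lipschitz_on UNIV G"
  shows "F y \<le> F x + inner (G x) (y - x) + M / 2 * (norm (y - x))\<^sup>2"
proof -
  let ?d = "y - x"
  \<comment> \<open>Up to the constant \<open>F x\<close>, this is \<open>F\<close> on the segment
    minus the claimed quadratic bound, so that \<open>\<psi> 1 \<le> \<psi> 0\<close> is the
    claim.\<close>
  define \<psi> where "\<psi> t = F (x + t *\<^sub>R ?d) - t * inner (G x) ?d - M / 2 * t\<^sup>2 * (norm ?d)\<^sup>2" for t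
  have "\<psi> 1 \<le> \<psi> 0"
  proof (rule DERIV_nonpos_imp_nonincreasing[of 0 1 \<psi>])
    fix t :: real assume t: "0 \<le> t" "t \<le> 1"
    let ?D = "inner (G (x + t *\<^sub>R ?d)) ?d - inner (G x) ?d - M * t * (norm ?d)\<^sup>2"
    have "DERIV \<psi> t :> ?D"
      unfolding \<psi>_def
      by (rule derivative_eq_intros DERIV_along_line deriv refl | simp)+
    moreover have "inner (G (x + t *\<^sub>R ?d) - G x) ?d \<le> M * t * (norm ?d)\<^sup>2"
    proof -
      have "inner (G (x + t *\<^sub>R ?d) - G x) ?d \<le> norm (G (x + t *\<^sub>R ?d) - G x) * norm ?d"
        by (rule norm_cauchy_schwarz)
      also have "\<dots> \<le> (M * norm (t *\<^sub>R ?d)) * norm ?d"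
        using lipschitz_onD[OF lip, of "x + t *\<^sub>R ?d" x]
        by (intro mult_right_mono) (auto simp: dist_norm)
      also have "\<dots> = M * t * (norm ?d)\<^sup>2" using t by (simp add: power2_eq_square)
      finally show ?thesis .
    qed
    ultimately show "\<exists>D. DERIV \<psi> t :> D \<and> D \<le> 0"
      by (auto simp: inner_diff_left)
  qed simp
  then show ?thesis by (simp add: \<psi>_def)
qed

text \<open>Half of the Baillon-Haddad theorem. The tangent at \<open>x\<close> is compared with the quadratic bound
  at \<open>y\<close> in the point \<open>y - t (G y - G x)\<close>, and conversely; the step \<open>t\<close> is kept free in order
  to include \<open>M = 0\<close>.\<close>

lemma quadratic_upper_bound_lipschitz_gradient:
  fixes g :: "'a::real_inner \<Rightarrow> real"
  assumes lower: "\<And>x y. g x + inner (G x) (y - x) \<le> g y"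
    and upper: "\<And>x y. g y \<le> g x + inner (G x) (y - x) + M / 2 * (norm (y - x))\<^sup>2"
    and M: "0 \<le> M"
  shows "M-lipschitz_on UNIV G"
proof (rule lipschitz_onI)
  fix x y
  have step: "g x + inner (G x) (y - x) + (t - M / 2 * t\<^sup>2) * (norm (G y - G x))\<^sup>2 \<le> g y"
    for x y and t :: real
  proof -
    let ?v = "G y - G x"
    have "g x + inner (G x) (y - t *\<^sub>R ?v - x)
      \<le> g y + inner (G y) (y - t *\<^sub>R ?v - y) + M / 2 * (norm (y - t *\<^sub>R ?v - y))\<^sup>2"
      using lower upper by (rule order_trans)
    moreover have "inner (G x) (y - t *\<^sub>R ?v - x) = inner (G x) (y - x) - t * inner (G x) ?v"
      by (simp add: inner_diff_right)
    moreover have "inner (G y) (y - t *\<^sub>R ?v - y) = - t * inner (G y) ?v"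
      by simp
    moreover have "(norm (y - t *\<^sub>R ?v - y))\<^sup>2 = t\<^sup>2 * (norm ?v)\<^sup>2"
      by (simp add: power_mult_distrib)
    moreover have "t * (norm ?v)\<^sup>2 = t * inner (G y) ?v - t * inner (G x) ?v"
      by (simp add: power2_norm_eq_inner inner_diff_left right_diff_distrib)
    ultimately show ?thesis by (simp add: algebra_simps)
  qed
  let ?v = "G y - G x"
  \<comment> \<open>Adding \<open>step\<close> for \<open>(x, y)\<close> and for
    \<open>(y, x)\<close> cancels the values of \<open>g\<close>. Cauchy-Schwarz then allows
    division by \<open>norm ?v\<close>.\<close>
  have t: "(2 * t - M * t\<^sup>2) * norm ?v \<le> norm (y - x)" for t
  proof (cases "?v = 0")
    case False
    have "(2 * t - M * t\<^sup>2) * (norm ?v)\<^sup>2 \<le> inner ?v (y - x)"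
      using step[of x y t] step[of y x t]
      by (simp add: algebra_simps norm_minus_commute[of "G x"] inner_diff_left inner_diff_right)
    also have "\<dots> \<le> norm ?v * norm (y - x)" by (rule norm_cauchy_schwarz)
    finally have "norm ?v * ((2 * t - M * t\<^sup>2) * norm ?v) \<le> norm ?v * norm (y - x)"
      by (simp add: power2_eq_square mult_ac)
    then show ?thesis using False by simp
  qed simp
  have "norm ?v \<le> M * norm (y - x)"
  proof (cases "M = 0")
    case True
    show ?thesis
    proof (cases "?v = 0")
      case False
      \<comment> \<open>With \<open>M = 0\<close> the left side of \<open>t\<close> grows linearly
        in the step without bound; this step is chosen so that it exceeds the right side.\<close>
      then have "2 * (norm (y - x) + 1) \<le> norm (y - x)"
        using t[of "(norm (y - x) + 1) / norm ?v"] \<open>M = 0\<close> by simp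
      moreover have "0 \<le> norm (y - x)" by simp
      ultimately have False by argo
      then show ?thesis ..
    qed (simp add: True)
  next
    case False
    \<comment> \<open>The step \<open>1 / M\<close> maximizes \<open>2 * t - M * t\<^sup>2\<close>
      and so gives the sharp constant.\<close>
    have "(2 * (1 / M) - M * (1 / M)\<^sup>2) = 1 / M"
      using False by (simp add: power2_eq_square)
    then have "norm ?v / M \<le> norm (y - x)" using t[of "1 / M"] by simp
    then show ?thesis using False M by (simp add: field_simps)
  qed
  then show "dist (G x) (G y) \<le> M * dist x y"
    by (metis dist_commute dist_norm)
qed (fact M)

text \<open>By convexity the gap between each summand and its tangent is nonnegative, and these gaps
  add up to the gap of the sum. So each of them inherits the quadratic bound of the sum, which
  convexity turns back into a Lipschitz bound for the gradient.\<close>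

lemma L_smooth_summand:
  fixes f :: "'i \<Rightarrow> 'a::euclidean_space \<Rightarrow> real"
  assumes fin: "finite C" and i: "i \<in> C"
    and conv: "\<And>j. j \<in> C \<Longrightarrow> convex_on UNIV (f j)"
    and deriv: "\<And>j x. j \<in> C \<Longrightarrow> f j differentiable (at x)"
    and smooth: "L_smooth M (\<lambda>x. \<Sum>j\<in>C. f j x)"
  shows "L_smooth M (f i)"
proof -
  let ?F = "\<lambda>x. \<Sum>j\<in>C. f j x"
  have F: "GDERIV ?F x :> gradient ?F x" for x
    using smooth by (intro GDERIV_gradient) (simp add: L_smooth_def)
  have grad: "gradient ?F x = (\<Sum>j\<in>C. gradient (f j) x)" for x
    by (intro gradient_eq GDERIV_sum GDERIV_gradient deriv)
  have lip: "M-lipschitz_on UNIV (gradient ?F)" using smooth by (simp add: L_smooth_def)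
  have lower: "f j x + inner (gradient (f j) x) (y - x) \<le> f j y" if "j \<in> C" for j x y
    using that by (intro convex_above_tangent conv GDERIV_gradient deriv)
  have "f i y \<le> f i x + inner (gradient (f i) x) (y - x) + M / 2 * (norm (y - x))\<^sup>2" for x y
  proof -
    have "f i y - f i x - inner (gradient (f i) x) (y - x)
      \<le> (\<Sum>j\<in>C. f j y - f j x - inner (gradient (f j) x) (y - x))"
      using i fin lower[of _ x y] by (intro member_le_sum) (auto simp: algebra_simps)
    also have "\<dots> = ?F y - ?F x - inner (gradient ?F x) (y - x)"
      by (simp add: grad sum_subtractf inner_sum_left)
    also have "\<dots> \<le> M / 2 * (norm (y - x))\<^sup>2"
      using lipschitz_gradient_quadratic_upper_bound[OF F lip, of y x] by simp
    finally show ?thesis by simp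
  qed
  then have "M-lipschitz_on UNIV (gradient (f i))"
    using lipschitz_on_nonneg[OF lip]
    by (rule quadratic_upper_bound_lipschitz_gradient[where g = "f i", OF lower[OF i]])
  then show ?thesis using deriv i by (simp add: L_smooth_def)
qed

section \<open>Smoothness constants of sums, multiples and block averages\<close>

lemma L_smooth_sum:
  fixes f :: "'i \<Rightarrow> 'a::euclidean_space \<Rightarrow> real"
  assumes "finite C" and "\<And>j. j \<in> C \<Longrightarrow> L_smooth (L j) (f j)"
  shows "L_smooth (\<Sum>j\<in>C. L j) (\<lambda>x. \<Sum>j\<in>C. f j x)"
proof -
  have diff: "f j differentiable (at x)" if "j \<in> C" for j x
    using assms(2) that by (simp add: L_smooth_def)
  have grad: "gradient (\<lambda>x. \<Sum>j\<in>C. f j x) = (\<lambda>x. \<Sum>j\<in>C. gradient (f j) x)"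
    by (intro ext gradient_eq GDERIV_sum GDERIV_gradient diff)
  have "(\<Sum>j\<in>C. L j)-lipschitz_on UNIV (\<lambda>x. \<Sum>j\<in>C. gradient (f j) x)"
    using assms
  proof (induction C rule: finite_induct)
    case empty
    then show ?case by (simp add: lipschitz_on_def)
  next
    case (insert j C)
    then show ?case by (simp add: lipschitz_on_add L_smooth_def)
  qed
  then show ?thesis
    unfolding L_smooth_def grad using diff assms(1) by (auto intro: differentiable_sum)
qed

lemma L_smooth_cmult:
  fixes g :: "'a::euclidean_space \<Rightarrow> real"
  assumes "L_smooth L g" and "0 \<le> c"
  shows "L_smooth (c * L) (\<lambda>x. c * g x)"
proof -
  have "gradient (\<lambda>x. c * g x) = (\<lambda>x. c *\<^sub>R gradient g x)"
    using assms by (intro ext gradient_eq GDERIV_cmult GDERIV_gradient) (simp add: L_smooth_def)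
  then show ?thesis
    using assms by (simp add: L_smooth_def lipschitz_on_cmult_nonneg differentiable_mult)
qed

lemma smoothness_const_le:
  assumes "L_smooth L g"
  shows "smoothness_const g \<le> L"
  unfolding smoothness_const_def
  by (rule cInf_lower) (use assms in \<open>auto intro!: bdd_belowI[of _ 0] simp: L_smooth_def lipschitz_on_def\<close>)

text \<open>The block sum is \<open>card C\<close> times the block average, so it is smooth with
  constant \<open>card C * L_block f C\<close>, and this constant passes to every convex summand.
  The inequality is what makes the slopes of the lines in both samplings nonnegative.\<close>

lemma L_max_le_card_L_block:
  fixes f :: "nat \<Rightarrow> 'a::euclidean_space \<Rightarrow> real"
  assumes fin: "finite C" and ne: "C \<noteq> {}"
    and conv: "\<And>i. i \<in> C \<Longrightarrow> convex_on UNIV (f i)"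
    and smooth: "\<And>i. i \<in> C \<Longrightarrow> \<exists>L. L_smooth L (f i)"
  shows "L_max f C \<le> real (card C) * L_block f C"
proof -
  have card: "real (card C) > 0" using fin ne by (simp add: card_gt_0_iff)
  obtain L where L: "\<And>i. i \<in> C \<Longrightarrow> L_smooth (L i) (f i)" using smooth by metis
  have avg: "avg_on f C = (\<lambda>x. 1 / real (card C) * (\<Sum>i\<in>C. f i x))"
    by (simp add: avg_on_def fun_eq_iff)
  \<comment> \<open>Some constant for the average is needed first: the infimum
    \<open>L_block f C\<close> is attained once the set of admissible constants is nonempty.\<close>
  have "L_smooth (1 / real (card C) * (\<Sum>i\<in>C. L i)) (avg_on f C)"
    unfolding avg using fin L by (intro L_smooth_cmult L_smooth_sum) auto
  then have "L_smooth (L_block f C) (avg_on f C)"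
    unfolding L_block_def by (rule L_smooth_smoothness_const)
  then have "L_smooth (real (card C) * L_block f C) (\<lambda>x. real (card C) * avg_on f C x)"
    by (rule L_smooth_cmult) simp
  then have "L_smooth (real (card C) * L_block f C) (\<lambda>x. \<Sum>i\<in>C. f i x)"
    using card by (simp add: avg_on_def)
  then have "L_smooth (real (card C) * L_block f C) (f i)" if "i \<in> C" for i
    using L that by (intro L_smooth_summand[OF fin that conv]) (auto simp: L_smooth_def)
  then show ?thesis
    unfolding L_max_def using fin ne by (auto intro!: smoothness_const_le)
qed

section \<open>Minimizing a maximum of lines\<close>

text \<open>The quotients are the abscissae where the lines \<open>a r * \<tau> + b r\<close> cross
  \<open>c * \<tau> + d\<close>. Left of the smallest one the nonincreasing line alone is at least
  the value there; right of it the nondecreasing line through that crossing is.\<close>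

lemma is_arg_min_max_lines:
  fixes a b :: "'i \<Rightarrow> real"
  assumes fin: "finite P" and ne: "P \<noteq> {}"
    and a: "\<And>r. r \<in> P \<Longrightarrow> 0 \<le> a r" and c: "c \<le> 0"
    and nz: "\<And>r. r \<in> P \<Longrightarrow> a r - c \<noteq> 0"
  shows "is_arg_min (\<lambda>\<tau>. max (MAX r\<in>P. a r * \<tau> + b r) (c * \<tau> + d)) (\<lambda>_. True)
    (MIN r\<in>P. (d - b r) / (a r - c))"
proof -
  let ?T = "MIN r\<in>P. (d - b r) / (a r - c)"
  have "?T \<in> (\<lambda>r. (d - b r) / (a r - c)) ` P" using fin ne by (intro Min_in) auto
  then obtain r0 where r0: "r0 \<in> P" "?T = (d - b r0) / (a r0 - c)" by blast
  \<comment> \<open>The signs of the slopes give \<open>a r - c \<ge> 0\<close>; the nonzero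
    denominator excludes two parallel horizontal lines.\<close>
  have pos: "a r - c > 0" if "r \<in> P" for r using a[OF that] c nz[OF that] by linarith
  have below: "a r * ?T + b r \<le> c * ?T + d" if "r \<in> P" for r
  proof -
    have "?T \<le> (d - b r) / (a r - c)" using fin that by (intro Min_le) auto
    then have "?T * (a r - c) \<le> d - b r" using pos[OF that] by (simp add: pos_le_divide_eq)
    then show ?thesis by (simp add: algebra_simps)
  qed
  have meet: "a r0 * ?T + b r0 = c * ?T + d"
  proof -
    have "?T * (a r0 - c) = d - b r0" unfolding r0(2) using pos[OF r0(1)] by simp
    then show ?thesis by (simp add: algebra_simps)
  qed
  have "max (MAX r\<in>P. a r * ?T + b r) (c * ?T + d) \<le> max (MAX r\<in>P. a r * \<tau> + b r) (c * \<tau> + d)" for \<tau>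
  proof -
    \<comment> \<open>At the first crossing no line has yet risen above
      \<open>c * \<tau> + d\<close>, so the maximum is the value of that line.\<close>
    have "max (MAX r\<in>P. a r * ?T + b r) (c * ?T + d) = c * ?T + d"
      using fin ne below by (simp add: max_absorb2)
    also have "\<dots> \<le> max (a r0 * \<tau> + b r0) (c * \<tau> + d)"
    proof (cases "\<tau> \<le> ?T")
      case True
      then show ?thesis using mult_left_mono_neg[OF True c] by linarith
    next
      case False
      then show ?thesis using mult_left_mono[OF _ a[OF r0(1)], of ?T \<tau>] meet by linarith
    qed
    also have "\<dots> \<le> max (MAX r\<in>P. a r * \<tau> + b r) (c * \<tau> + d)"
      using fin r0(1) by (intro max.mono Max_ge) auto
    finally show ?thesis .
  qed
  then show ?thesis by (simp add: is_arg_min_linorder)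
qed

lemma is_arg_min_max_nondecreasing_lines:
  fixes a b :: "'i \<Rightarrow> real"
  assumes fin: "finite P" and ne: "P \<noteq> {}"
    and a: "\<And>r. r \<in> P \<Longrightarrow> 0 \<le> a r" and c: "0 \<le> c"
  shows "is_arg_min (\<lambda>\<tau>. max (MAX r\<in>P. a r * \<tau> + b r) (c * \<tau> + d)) (\<lambda>\<tau>. t0 \<le> \<tau>) t0"
proof -
  have "max (MAX r\<in>P. a r * t0 + b r) (c * t0 + d) \<le> max (MAX r\<in>P. a r * \<tau> + b r) (c * \<tau> + d)"
    if \<tau>: "t0 \<le> \<tau>" for \<tau>
  proof (rule max.mono)
    show "(MAX r\<in>P. a r * t0 + b r) \<le> (MAX r\<in>P. a r * \<tau> + b r)"
    proof (rule Max.boundedI)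
      fix u assume "u \<in> (\<lambda>r. a r * t0 + b r) ` P"
      then obtain r where r: "r \<in> P" "u = a r * t0 + b r" by blast
      then have "u \<le> a r * \<tau> + b r" using \<tau> a by (simp add: mult_left_mono)
      also have "\<dots> \<le> (MAX r\<in>P. a r * \<tau> + b r)" using fin r by (intro Max_ge) auto
      finally show "u \<le> (MAX r\<in>P. a r * \<tau> + b r)" .
    qed (use fin ne in auto)
    show "c * t0 + d \<le> c * \<tau> + d" using \<tau> c by (simp add: mult_left_mono)
  qed
  then show ?thesis by (simp add: is_arg_min_linorder)
qed

lemma cmult_Max_image:
  fixes k :: real
  assumes "finite P" and "P \<noteq> {}" and "0 \<le> k"
  shows "k * (MAX r\<in>P. g r) = (MAX r\<in>P. k * g r)"
  using mono_Max_commute[of "(*) k" "g ` P"] assms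
  by (simp add: image_image mono_def mult_left_mono)

text \<open>In both samplings, numerator and denominator in the formula for the optimal batch size are
  those of the intersection point of two lines, multiplied by \<open>n\<^sup>2\<close>.\<close>

lemma complexity_arg_min:
  fixes a b :: "'i \<Rightarrow> real"
  assumes fin: "finite P" and ne: "P \<noteq> {}" and n: "n \<ge> 1" and k: "k > 0"
    and a: "\<And>r. r \<in> P \<Longrightarrow> 0 \<le> a r"
    and L: "\<And>\<tau>. tau_L \<tau> = 1 / real n * (MAX r\<in>P. a r * \<tau> + b r)"
    and \<sigma>: "\<And>\<tau>. tau_sigma \<tau> = 1 / (real n)\<^sup>2 * (c * \<tau> + d)"
    and num: "\<And>r. r \<in> P \<Longrightarrow> num r = k * d - real n * b r"
    and den: "\<And>r. r \<in> P \<Longrightarrow> den r = real n * a r - k * c"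
    and k_def: "k = 2 / (\<epsilon> * \<mu>)"
  shows "if c \<le> 0 then (\<forall>r\<in>P. den r \<noteq> 0) \<longrightarrow>
      is_arg_min (complexity \<epsilon> \<mu> tau_L tau_sigma) (\<lambda>_. True) (MIN r\<in>P. num r / den r)
    else is_arg_min (complexity \<epsilon> \<mu> tau_L tau_sigma) (\<lambda>\<tau>. \<tau> \<ge> 1) 1"
proof -
  \<comment> \<open>The primed coefficients absorb the outer factors \<open>1 / n\<close> and
    \<open>k / n\<^sup>2\<close>, which leaves a plain maximum of lines.\<close>
  define a' b' c' d'
    where "a' r = a r / real n" and "b' r = b r / real n"
      and "c' = k * c / (real n)\<^sup>2" and "d' = k * d / (real n)\<^sup>2" for r
  have eq: "complexity \<epsilon> \<mu> tau_L tau_sigma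
    = (\<lambda>\<tau>. max (MAX r\<in>P. a' r * \<tau> + b' r) (c' * \<tau> + d'))"
  proof
    fix \<tau>
    have "tau_L \<tau> = (MAX r\<in>P. 1 / real n * (a r * \<tau> + b r))"
      unfolding L by (rule cmult_Max_image) (use fin ne in auto)
    also have "(\<lambda>r. 1 / real n * (a r * \<tau> + b r)) = (\<lambda>r. a' r * \<tau> + b' r)"
      by (simp add: a'_def b'_def fun_eq_iff add_divide_distrib)
    finally have "tau_L \<tau> = (MAX r\<in>P. a' r * \<tau> + b' r)" .
    moreover have "2 / (\<epsilon> * \<mu>) * tau_sigma \<tau> = c' * \<tau> + d'"
      unfolding \<sigma> k_def[symmetric] c'_def d'_def by (simp add: add_divide_distrib distrib_left)
    ultimately show "complexity \<epsilon> \<mu> tau_L tau_sigma \<tau>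
        = max (MAX r\<in>P. a' r * \<tau> + b' r) (c' * \<tau> + d')"
      unfolding complexity_def by (rule arg_cong2)
  qed
  have a': "0 \<le> a' r" if "r \<in> P" for r using a[OF that] by (simp add: a'_def)
  have num': "num r = (real n)\<^sup>2 * (d' - b' r)" if "r \<in> P" for r
    using n num[OF that] by (simp add: b'_def d'_def right_diff_distrib power2_eq_square)
  have den': "den r = (real n)\<^sup>2 * (a' r - c')" if "r \<in> P" for r
    using n den[OF that] by (simp add: a'_def c'_def right_diff_distrib power2_eq_square)
  show ?thesis
  proof (cases "c \<le> 0")
    case True
    then have c': "c' \<le> 0" using k by (simp add: c'_def divide_nonpos_nonneg mult_nonneg_nonpos)
    have "is_arg_min (complexity \<epsilon> \<mu> tau_L tau_sigma) (\<lambda>_. True) (MIN r\<in>P. num r / den r)"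
      if nz: "\<forall>r\<in>P. den r \<noteq> 0"
    proof -
      \<comment> \<open>The common factor \<open>n\<^sup>2\<close> of \<open>num'\<close> and
        \<open>den'\<close> cancels.\<close>
      have "(\<lambda>r. num r / den r) ` P = (\<lambda>r. (d' - b' r) / (a' r - c')) ` P"
        using n by (intro image_cong) (simp_all add: num' den')
      moreover have "a' r - c' \<noteq> 0" if "r \<in> P" for r using nz den'[OF that] that by auto
      ultimately show ?thesis
        unfolding eq using is_arg_min_max_lines[OF fin ne a' c'] by simp
    qed
    then show ?thesis using True by simp
  next
    case False
    then have "0 \<le> c'" using k by (simp add: c'_def)
    then show ?thesis
      unfolding eq using False is_arg_min_max_nondecreasing_lines[OF fin ne a'] by simp
  qed
qed

section \<open>The lines belonging to the nice and to the independent sampling\<close>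

theorem theorem3:
  fixes n :: nat
    and f :: "nat \<Rightarrow> real ^ 'd \<Rightarrow> real"
    and xstar :: "real ^ 'd"
    and \<mu> \<epsilon> :: real
    and P :: "nat set set"
    and q :: "nat set \<Rightarrow> real"
  assumes "n \<ge> 1"
    and "\<And>i. i \<in> {1..n} \<Longrightarrow> convex_on UNIV (f i)"
    and "\<And>i. i \<in> {1..n} \<Longrightarrow> \<exists>L. L_smooth L (f i)"
    and "\<mu> > 0"
    and "strongly_convex \<mu> (avg_on f {1..n})"
    and "is_arg_min (avg_on f {1..n}) (\<lambda>_. True) xstar"
    and "\<epsilon> > 0"
    and "partition_on {1..n} P"
    and "\<And>C. C \<in> P \<Longrightarrow> q C > 0"
    and "(\<Sum>C\<in>P. q C) = 1"
  shows
    "((\<forall>C\<in>P. card C \<ge> 2) \<longrightarrow>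
       (if (\<Sum>C\<in>P. (real (card C))\<^sup>2 / e_block q C *
              (h_block f C xstar * real (card C) - h_bar f C xstar)) \<le> 0
        then (\<forall>R\<in>P. nice_den n P q f \<epsilon> \<mu> xstar R \<noteq> 0) \<longrightarrow>
               is_arg_min
             (complexity \<epsilon> \<mu> (nice_tau_L n P q f) (nice_tau_sigma n P q f xstar))
             (\<lambda>_. True) (nice_tau n P q f \<epsilon> \<mu> xstar)
        else is_arg_min
             (complexity \<epsilon> \<mu> (nice_tau_L n P q f) (nice_tau_sigma n P q f xstar))
             (\<lambda>\<tau>. \<tau> \<ge> 1) 1))
     \<and>
     (if (\<Sum>C\<in>P. real (card C) / q C *
              (real (card C) * h_block f C xstar - h_bar f C xstar)) \<le> 0
      then (\<forall>R\<in>P. indep_den n P q f \<epsilon> \<mu> xstar R \<noteq> 0) \<longrightarrow>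
             is_arg_min
             (complexity \<epsilon> \<mu> (indep_tau_L n P q f) (indep_tau_sigma n P q f xstar))
             (\<lambda>_. True) (indep_tau n P q f \<epsilon> \<mu> xstar)
      else is_arg_min
             (complexity \<epsilon> \<mu> (indep_tau_L n P q f) (indep_tau_sigma n P q f xstar))
             (\<lambda>\<tau>. \<tau> \<ge> 1) 1)"
proof -
  have fin: "finite P" using assms(8) finite_elements by blast
  have ne: "P \<noteq> {}" using assms(1,8) by (auto simp: partition_on_def)
  have sub: "C \<subseteq> {1..n}" "C \<noteq> {}" "finite C" if "C \<in> P" for C
    using assms(8) that by (auto simp: partition_on_def intro: finite_subset)
  have slope: "L_max f C \<le> real (card C) * L_block f C" if "C \<in> P" for C
    using sub[OF that] assms(2,3) by (intro L_max_le_card_L_block) blast+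
  have k: "2 / (\<epsilon> * \<mu>) > 0" using assms(4,7) by simp
  show ?thesis (is "(?A \<longrightarrow> ?nice) \<and> ?indep")
  proof (intro conjI impI)
    assume ge2: ?A
    \<comment> \<open>Collecting powers of \<open>\<tau>\<close> in the bracket of each block gives
      slope \<open>?a\<close> and intercept \<open>?b\<close> for the smoothness part, and after
      summation \<open>?c\<close> and \<open>?d\<close> for the noise part. The slope
      \<open>?c\<close> is the sum whose sign decides the case.\<close>
    let ?w = "\<lambda>C. (real (card C))\<^sup>2 / e_block q C"
    let ?a = "\<lambda>C. real (card C) / e_block q C * (real (card C) * L_block f C - L_max f C)"
    let ?b = "\<lambda>C. (real (card C))\<^sup>2 / e_block q C * (L_max f C - L_block f C)"
    let ?c = "\<Sum>C\<in>P. ?w C * (h_block f C xstar * real (card C) - h_bar f C xstar)"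
    let ?d = "\<Sum>C\<in>P. (real (card C))^3 / e_block q C * (h_bar f C xstar - h_block f C xstar)"
    \<comment> \<open>The factor \<open>card C - 1\<close> in \<open>e_block\<close> is positive
      because blocks have at least two elements; this carries the sign of \<open>slope\<close> over
      to \<open>?a\<close>.\<close>
    have e: "e_block q C > 0" if "C \<in> P" for C
      using ge2 assms(9) that by (fastforce simp: e_block_def)
    show ?nice
      unfolding nice_tau_def
    proof (rule complexity_arg_min[OF fin ne assms(1) k, where a = ?a and b = ?b and d = ?d])
      show "0 \<le> ?a C" if "C \<in> P" for C using e[OF that] slope[OF that] by simp
      show "nice_tau_L n P q f \<tau> = 1 / real n * (MAX C\<in>P. ?a C * \<tau> + ?b C)" for \<tau>
      proof -
        have "real (card C) / e_block q C * ((\<tau> - 1) * L_block f C * real (card C)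
            + (real (card C) - \<tau>) * L_max f C) = ?a C * \<tau> + ?b C" for C
          by (simp add: divide_simps power2_eq_square) (simp add: algebra_simps)
        then show ?thesis by (simp only: nice_tau_L_def)
      qed
      show "nice_tau_sigma n P q f xstar \<tau> = 1 / (real n)\<^sup>2 * (?c * \<tau> + ?d)" for \<tau>
      proof -
        have "?w C * ((\<tau> - 1) * h_block f C xstar * real (card C)
            + (real (card C) - \<tau>) * h_bar f C xstar)
          = ?w C * (h_block f C xstar * real (card C) - h_bar f C xstar) * \<tau>
            + (real (card C))^3 / e_block q C * (h_bar f C xstar - h_block f C xstar)" for C
          by (simp add: divide_simps power2_eq_square power3_eq_cube) (simp add: algebra_simps)
        then show ?thesis by (simp only: nice_tau_sigma_def sum.distrib sum_distrib_right)
      qed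
      show "nice_num n P q f \<epsilon> \<mu> xstar C = 2 / (\<epsilon> * \<mu>) * ?d - real n * ?b C" for C
        by (simp add: nice_num_def algebra_simps diff_divide_distrib)
      show "nice_den n P q f \<epsilon> \<mu> xstar C = real n * ?a C - 2 / (\<epsilon> * \<mu>) * ?c" for C
      proof -
        \<comment> \<open>The denominator is written with the differences in the opposite order,
          hence with minus the noise slope.\<close>
        have "(\<Sum>C\<in>P. ?w C * (h_bar f C xstar - real (card C) * h_block f C xstar)) = - ?c"
          unfolding sum_negf[symmetric] by (intro sum.cong refl) (simp add: algebra_simps)
        then show ?thesis by (simp add: nice_den_def)
      qed
    qed (rule refl)
  next
    \<comment> \<open>Again slopes and intercepts in \<open>\<tau>\<close>. Here the brackets
      contain \<open>\<tau>\<close> rather than \<open>\<tau> - 1\<close>, so at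
      \<open>\<tau> = 0\<close> only \<open>L_max\<close> and \<open>h_bar\<close> survive in
      \<open>?b\<close> and \<open>?d\<close>.\<close>
    let ?w = "\<lambda>C. real (card C) / q C"
    let ?a = "\<lambda>C. 1 / q C * (real (card C) * L_block f C - L_max f C)"
    let ?b = "\<lambda>C. real (card C) / q C * L_max f C"
    let ?c = "\<Sum>C\<in>P. ?w C * (real (card C) * h_block f C xstar - h_bar f C xstar)"
    let ?d = "\<Sum>C\<in>P. (real (card C))\<^sup>2 / q C * h_bar f C xstar"
    show ?indep
      unfolding indep_tau_def
    proof (rule complexity_arg_min[OF fin ne assms(1) k, where a = ?a and b = ?b and d = ?d])
      show "0 \<le> ?a C" if "C \<in> P" for C using assms(9)[OF that] slope[OF that] by simp
      show "indep_tau_L n P q f \<tau> = 1 / real n * (MAX C\<in>P. ?a C * \<tau> + ?b C)" for \<tau>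
      proof -
        have "1 / q C * (\<tau> * real (card C) * L_block f C + (real (card C) - \<tau>) * L_max f C)
          = ?a C * \<tau> + ?b C" for C
          by (simp add: divide_simps) (simp add: algebra_simps)
        then show ?thesis by (simp only: indep_tau_L_def)
      qed
      show "indep_tau_sigma n P q f xstar \<tau> = 1 / (real n)\<^sup>2 * (?c * \<tau> + ?d)" for \<tau>
      proof -
        have "1 / q C * (\<tau> * (real (card C))\<^sup>2 * h_block f C xstar
            + (real (card C) - \<tau>) * real (card C) * h_bar f C xstar)
          = ?w C * (real (card C) * h_block f C xstar - h_bar f C xstar) * \<tau>
            + (real (card C))\<^sup>2 / q C * h_bar f C xstar" for C
          by (simp add: divide_simps power2_eq_square) (simp add: algebra_simps)
        then show ?thesis by (simp only: indep_tau_sigma_def sum.distrib sum_distrib_right)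
      qed
      show "indep_num n P q f \<epsilon> \<mu> xstar C = 2 / (\<epsilon> * \<mu>) * ?d - real n * ?b C" for C
        by (simp add: indep_num_def)
      show "indep_den n P q f \<epsilon> \<mu> xstar C = real n * ?a C - 2 / (\<epsilon> * \<mu>) * ?c" for C
      proof -
        have "(\<Sum>C\<in>P. ?w C * (h_bar f C xstar - real (card C) * h_block f C xstar)) = - ?c"
          unfolding sum_negf[symmetric] by (intro sum.cong refl) (simp add: algebra_simps)
        then show ?thesis by (simp add: indep_den_def)
      qed
    qed (rule refl)
  qed
qed

end
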